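(* Let $a,b,c$ be positive numbers with $a<b<c$, $\lfloor c/b\rfloor\ge2$, $b-a<c_0<a$, $0<c_1<2a-b$, and $a/b\notin\mathbb Q$, where $c_0=c-\lfloor c/b\rfloor b$ and $c_1=c-c_0-\lfloor(c-c_0)/a\rfloor a$. Then $\mathcal S_{a,b,c}\ne\emptyset$ if and only if there exist nonnegative integers $d_1,d_2$ such that (1) $c-(d_1+1)(\lfloor c/b\rfloor+1)(b-a)-(d_2+1)\lfloor c/b\rfloor(b-a)\in a\mathbb Z$; (2) $\lfloor c/b\rfloor b+(d_1+1)(b-a)<c<\lfloor c/b\rfloor b+b-(d_2+1)(b-a)$; (3) $\#E_{a,b,c}=d_1$, where, with $m=\big((d_1+d_2+1)c_1-c_0+(d_1+1)(b-a)\big)/a$, $E_{a,b,c}=\{n\in\mathbb Z\cap[1,d_1+d_2+1]: n(c_1-m(b-a))\in[0,c_0-(d_1+1)(b-a))+(a-(d_1+d_2+1)(b-a))\mathbb Z\}$.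
   Context: For $a,b,c>0$ and $t\in\mathbb R$, $\mathbf M_{a,b,c}(t)=(\chi_{[0,c)}(t-\mu+\lambda))_{\mu\in a\mathbb Z,\lambda\in b\mathbb Z}$ is the infinite matrix with rows indexed by $a\mathbb Z$ and columns by $b\mathbb Z$, acting by $(\mathbf M_{a,b,c}(t)\mathbf x)(\mu)=\sum_{\lambda\in b\mathbb Z}\chi_{[0,c)}(t-\mu+\lambda)\mathbf x(\lambda)$. $\mathcal B_b^0$ is the set of vectors $(\mathbf x(\lambda))_{\lambda\in b\mathbb Z}$ with entries in $\{0,1\}$ and $\mathbf x(0)=1$. $\mathbf 1$ denotes the vector indexed by $a\mathbb Z$ with all entries $1$. $\mathcal S_{a,b,c}=\{t:\mathbf M_{a,b,c}(t)\mathbf x=\mathbf 1\text{ for some }\mathbf x\in\mathcal B_b^0\}$. $\#$ denotes cardinality and $A+r\mathbb Z=\{x+rk:x\in A,k\in\mathbb Z\}$. *)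

theory Defs
  imports Complex_Main
begin

text \<open>Vectors indexed by b*Z are represented as functions on int (index k stands for lambda = k*b);
rows indexed by a*Z are indexed by j (mu = j*a).\<close>

definition Mentry :: "real \<Rightarrow> real \<Rightarrow> real \<Rightarrow> real \<Rightarrow> int \<Rightarrow> int \<Rightarrow> real" where
  "Mentry a b c t j k = (if t - a * of_int j + b * of_int k \<in> {0..<c} then 1 else 0)"

text \<open>(M x)(mu) : only finitely many entries of a row are nonzero, so the row sum is a finite sum
over the support of the row.\<close>
definition Mmult :: "real \<Rightarrow> real \<Rightarrow> real \<Rightarrow> real \<Rightarrow> (int \<Rightarrow> real) \<Rightarrow> int \<Rightarrow> real" where
  "Mmult a b c t x j = (\<Sum>k\<in>{k::int. Mentry a b c t j k \<noteq> 0}. Mentry a b c t j k * x k)"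

definition B0 :: "(int \<Rightarrow> real) set" where
  "B0 = {x. (\<forall>k. x k \<in> {0, 1}) \<and> x 0 = 1}"

definition S_set :: "real \<Rightarrow> real \<Rightarrow> real \<Rightarrow> real set" where
  "S_set a b c = {t. \<exists>x\<in>B0. \<forall>j::int. Mmult a b c t x j = 1}"

definition lattice :: "real \<Rightarrow> real set" where
  "lattice r = {r * of_int k | k::int. True}"

definition plus_lattice :: "real set \<Rightarrow> real \<Rightarrow> real set" where
  "plus_lattice A r = {x + r * of_int k | x k. x \<in> A \<and> (k::int) = k}"

end

theory Submission
  imports Defs "HOL-Library.Real_Mod"
begin

text \<open>
  Let \<open>T = {t + bk. x k = 1}\<close>; the equations say that every window \<open>[aj, aj + c)\<close> contains exactly
  one point of \<open>T\<close>. With \<open>\<delta> = b - a\<close> and residues modulo \<open>a\<close>, the point of \<open>T\<close> following \<open>\<tau>\<close> is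
  \<open>\<tau> + (N + 1) b\<close> if \<open>\<tau> < c0 - \<delta>\<close> and \<open>\<tau> + N b\<close> if \<open>\<tau> \<ge> c0\<close>, and no such point exists if \<open>\<tau>\<close> lies in
  the hole \<open>[c0 - \<delta>, c0)\<close>. Thus \<open>P = T + a\<int>\<close> is mapped bijectively and monotonically onto itself by
  \<open>F s = s + c1 + \<delta>\<close> (\<open>s < c0\<close>), \<open>F s = s + c1\<close> (\<open>s \<ge> c0\<close>). A gap of \<open>P\<close> is translated by \<open>F\<close>,
  except that a gap at \<open>0\<close> grows by \<open>\<delta>\<close> and a gap at \<open>c0\<close> shrinks by \<open>\<delta>\<close>. As \<open>a / b\<close> is irrational,
  no gap is periodic, and infinitely many disjoint gaps of equal length do not fit into a circle.
  Hence the gap of length \<open>\<delta>\<close> created at \<open>0\<close> is carried after finitely many steps exactly onto the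
  hole, with \<open>d1\<close> intermediate gaps below \<open>c0\<close> and \<open>d2\<close> above. Collapsing these \<open>D = d1 + d2 + 1\<close>
  gaps turns \<open>F\<close> into the rotation by \<open>\<theta> = c1 - m\<delta>\<close> of a circle of length \<open>L = a - D\<delta>\<close>, which gives
  the three conditions. Conversely, opening gaps of length \<open>\<delta>\<close> at the points \<open>\<theta>, \<dots>, D\<theta>\<close> of such a
  rotation turns the orbit of \<open>0\<close> into a set \<open>T\<close> with the required property.
\<close>

section \<open>Residues, packing and counting\<close>

lemma rmod_add_floor: "0 < a \<Longrightarrow> x rmod a + a * of_int \<lfloor>x / a\<rfloor> = x"
  by (simp add: rmod_def)

lemma rmod_eq_add_multiple: "0 < a \<Longrightarrow> x rmod a = x + a * of_int (- \<lfloor>x / a\<rfloor>)"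
  by (simp add: rmod_def)

lemma rmod_add_multiple [simp]: "(x + a * of_int j) rmod a = x rmod a"
proof -
  have "[x = x + of_int j * a] (rmod a)"
    unfolding rcong_altdef by blast
  then show ?thesis
    by (simp add: rcong_def mult.commute)
qed

lemma rmod_translate:
  assumes "0 < a" "0 \<le> x rmod a + d" "x rmod a + d < a"
  shows "(x + d) rmod a = x rmod a + d"
  by (rule rmod_unique[of _ _ _ "\<lfloor>x / a\<rfloor>"])
    (use assms rmod_add_floor[of a x] in \<open>auto simp: mult.commute\<close>)

lemma le_floor_divide_iff: "0 < a \<Longrightarrow> j \<le> \<lfloor>x / a\<rfloor> \<longleftrightarrow> a * of_int j \<le> x" for a x :: real
  by (simp add: le_floor_iff pos_le_divide_eq mult.commute)

lemma floor_divide_eq_iff: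
  fixes a x :: real
  assumes "0 < a"
  shows "\<lfloor>x / a\<rfloor> = j \<longleftrightarrow> 0 \<le> x - a * of_int j \<and> x - a * of_int j < a"
  using assms by (simp add: floor_eq_iff pos_le_divide_eq pos_divide_less_eq algebra_simps)

lemma floor_diff_divide:
  fixes a x y :: real
  assumes "0 < a"
  shows "\<lfloor>(x - y) / a\<rfloor> = \<lfloor>x / a\<rfloor> - \<lfloor>y / a\<rfloor> - of_bool (x rmod a < y rmod a)"
  unfolding floor_divide_eq_iff[OF assms]
  using rmod_nonneg[of a x] rmod_less[of a x] rmod_nonneg[of a y] rmod_less[of a y]
    rmod_add_floor[OF assms, of x] rmod_add_floor[OF assms, of y] assms
  by (auto simp: algebra_simps)

lemma mem_plus_lattice_iff:
  assumes "0 < L" "l \<le> L"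
  shows "x \<in> plus_lattice {0..<l} L \<longleftrightarrow> x rmod L < l"
proof
  assume "x \<in> plus_lattice {0..<l} L"
  then obtain y k where "x = y + L * of_int k" "0 \<le> y" "y < l"
    unfolding plus_lattice_def by auto
  then show "x rmod L < l"
    using assms by simp
next
  assume "x rmod L < l"
  then have "x rmod L \<in> {0..<l}" "x = x rmod L + L * of_int \<lfloor>x / L\<rfloor>"
    using assms(1) by (simp_all add: rmod_nonneg rmod_add_floor)
  then show "x \<in> plus_lattice {0..<l} L"
    unfolding plus_lattice_def by blast
qed

lemma packing_bound:
  fixes f :: "'i \<Rightarrow> real"
  assumes "finite I" "inj_on f I" "x \<le> y"
    and "\<And>i. i \<in> I \<Longrightarrow> x + \<delta> \<le> f i \<and> f i \<le> y"
    and "\<And>i j. i \<in> I \<Longrightarrow> j \<in> I \<Longrightarrow> f i < f j \<Longrightarrow> f i + \<delta> \<le> f j"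
  shows "\<delta> * of_nat (card I) \<le> y - x"
  using assms
proof (induction I arbitrary: y rule: finite_ranking_induct[where f = f])
  case (insert m I)
  show ?case
  proof (cases "m \<in> I")
    case True
    then show ?thesis
      using insert by (simp add: insert_absorb)
  next
    case False
    have below: "f i + \<delta> \<le> f m" if "i \<in> I" for i
    proof -
      have "f i \<noteq> f m"
        using insert.prems(1) that False by (auto simp: inj_on_def)
      then have "f i < f m"
        using insert.hyps(2)[OF that] by simp
      then show ?thesis
        using insert.prems(4) that by simp
    qed
    have "\<delta> * of_nat (card I) \<le> (f m - \<delta>) - x"
      by (rule insert.IH) (use insert.prems below in \<open>auto simp: le_diff_eq\<close>)
    moreover have "f m \<le> y"
      using insert.prems(3) by simp
    ultimately show ?thesis
      using False insert.hyps(1) by (simp add: algebra_simps)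
  qed
qed simp

text \<open>For \<open>y \<ge> 0\<close> this counts the points of \<open>{z 1, \<dots>, z D} + L\<int>\<close> in \<open>[0, y]\<close>.\<close>

definition periodic_count :: "real \<Rightarrow> (nat \<Rightarrow> real) \<Rightarrow> nat \<Rightarrow> real \<Rightarrow> int" where
  "periodic_count L z D y = int D * \<lfloor>y / L\<rfloor> + int (card {i \<in> {1..D}. z i rmod L \<le> y rmod L})"

lemma periodic_count_eq_sum:
  assumes "0 < L"
  shows "periodic_count L z D y = (\<Sum>i<D. \<lfloor>(y - z (Suc i)) / L\<rfloor> + \<lfloor>z (Suc i) / L\<rfloor> + 1)"
proof -
  have "(\<Sum>i<D. \<lfloor>(y - z (Suc i)) / L\<rfloor> + \<lfloor>z (Suc i) / L\<rfloor> + 1)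
      = (\<Sum>i<D. \<lfloor>y / L\<rfloor> + of_bool (z (Suc i) rmod L \<le> y rmod L))"
    by (rule sum.cong) (auto simp: floor_diff_divide[OF assms])
  also have "\<dots> = int D * \<lfloor>y / L\<rfloor> + (\<Sum>i\<in>{1..D}. of_bool (z i rmod L \<le> y rmod L))"
    by (simp add: sum.distrib sum.atLeast1_atMost_eq)
  also have "(\<Sum>i\<in>{1..D}. of_bool (z i rmod L \<le> y rmod L))
      = int (card {i \<in> {1..D}. z i rmod L \<le> y rmod L})"
    by (simp add: Int_def)
  finally show ?thesis
    by (simp add: periodic_count_def)
qed

lemma periodic_count_step:
  assumes "0 < L" "z 0 = 0" "z D = l + L * of_int k" "0 \<le> l" "l < L"
    and "\<And>i. i < D \<Longrightarrow> \<lfloor>(y' - z (Suc i)) / L\<rfloor> = \<lfloor>(y - z i) / L\<rfloor>"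
  shows "periodic_count L z D y' = periodic_count L z D y + k + of_bool (y rmod L < l)"
proof -
  let ?f = "\<lambda>i. \<lfloor>(y - z i) / L\<rfloor>"
  have "periodic_count L z D y' - periodic_count L z D y = (\<Sum>i<D. ?f i - ?f (Suc i))"
    unfolding periodic_count_eq_sum[OF assms(1)] sum_subtractf[symmetric]
    by (rule sum.cong) (use assms(6) in auto)
  also have "\<dots> = ?f 0 - ?f D"
    by (rule sum_lessThan_telescope')
  also have "\<lfloor>z D / L\<rfloor> = k" "z D rmod L = l"
    using assms(1,3,4,5) by (simp_all add: floor_divide_eq_iff)
  then have "?f D = \<lfloor>y / L\<rfloor> - k - of_bool (y rmod L < l)"
    by (simp add: floor_diff_divide[OF assms(1)])
  finally show ?thesis
    using assms(2) by simp
qed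

section \<open>Adherent points and gaps\<close>

definition right_adherent :: "real set \<Rightarrow> real \<Rightarrow> bool" where
  "right_adherent P r \<longleftrightarrow> (\<forall>s>r. \<exists>x\<in>P. r \<le> x \<and> x < s)"

definition gap_below :: "real set \<Rightarrow> real \<Rightarrow> real \<Rightarrow> bool" where
  "gap_below P r \<gamma> \<longleftrightarrow> (\<forall>x\<in>P. x < r \<longrightarrow> x \<le> r - \<gamma>)"

definition entry_point :: "real set \<Rightarrow> real \<Rightarrow> real" where
  "entry_point P s = Inf {x \<in> P. s \<le> x}"

lemma gap_below_antimono: "gap_below P r \<gamma> \<Longrightarrow> \<gamma>' \<le> \<gamma> \<Longrightarrow> gap_below P r \<gamma>'"
  unfolding gap_below_def by force

lemma right_adherent_le_gap_below:
  assumes "right_adherent P r" "gap_below P s \<gamma>" "r < s"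
  shows "r \<le> s - \<gamma>"
proof -
  obtain x where "x \<in> P" "r \<le> x" "x < s"
    using assms(1,3) unfolding right_adherent_def by blast
  then show ?thesis
    using assms(2) unfolding gap_below_def by force
qed

lemma entry_point_le:
  assumes "x \<in> P" "s \<le> x"
  shows "entry_point P s \<le> x"
  unfolding entry_point_def by (rule cInf_lower) (use assms in \<open>auto intro: bdd_belowI[of _ s]\<close>)

lemma entry_point_le_right_adherent:
  assumes "right_adherent P r" "s \<le> r"
  shows "entry_point P s \<le> r"
proof (rule field_le_epsilon)
  fix e :: real assume "0 < e"
  then have "r < r + e"
    by simp
  then obtain x where "x \<in> P" "r \<le> x" "x < r + e"
    using assms(1) unfolding right_adherent_def by blast
  then show "entry_point P s \<le> r + e"
    using entry_point_le[of x P s] assms(2) by linarith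
qed

lemma
  assumes "x \<in> P" "s \<le> x"
  shows entry_point_ge: "s \<le> entry_point P s"
    and right_adherent_entry_point: "right_adherent P (entry_point P s)"
proof -
  have bdd: "bdd_below {x \<in> P. s \<le> x}"
    by (rule bdd_belowI[of _ s]) simp
  have nonempty: "{x \<in> P. s \<le> x} \<noteq> {}"
    using assms by blast
  show "s \<le> entry_point P s"
    unfolding entry_point_def by (rule cInf_greatest[OF nonempty]) simp
  show "right_adherent P (entry_point P s)"
    unfolding right_adherent_def
  proof (intro allI impI)
    fix u assume "entry_point P s < u"
    then obtain y where "y \<in> P" "s \<le> y" "y < u"
      using cInf_less_iff[OF nonempty bdd] unfolding entry_point_def by auto
    then show "\<exists>x\<in>P. entry_point P s \<le> x \<and> x < u"
      using entry_point_le by blast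
  qed
qed

lemma gap_below_entry_point:
  assumes "gap_below P s \<gamma>"
  shows "gap_below P (entry_point P s) (entry_point P s - s + \<gamma>)"
  unfolding gap_below_def
proof (intro ballI impI)
  fix x assume x: "x \<in> P" "x < entry_point P s"
  then have "x < s"
    using entry_point_le[of x P s] by force
  then show "x \<le> entry_point P s - (entry_point P s - s + \<gamma>)"
    using assms x(1) unfolding gap_below_def by simp
qed

section \<open>Window tilings\<close>

lemma Mmult_eq_1_iff:
  assumes "0 < b" "\<And>k. x k \<in> {0, 1}"
  shows "Mmult a b c t x j = 1 \<longleftrightarrow> (\<exists>!k. t - a * of_int j + b * of_int k \<in> {0..<c} \<and> x k = 1)"
proof -
  define u where "u = t - a * of_int j"
  define K where "K = {k :: int. u + b * of_int k \<in> {0..<c}}"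
  have "K \<subseteq> {\<lfloor>- u / b\<rfloor>..\<lceil>(c - u) / b\<rceil>}"
  proof
    fix k assume "k \<in> K"
    then have "- u \<le> of_int k * b" "of_int k * b \<le> c - u"
      by (auto simp: K_def algebra_simps)
    then have "- u / b \<le> of_int k" "of_int k \<le> (c - u) / b"
      using pos_divide_le_eq[OF assms(1)] pos_le_divide_eq[OF assms(1)] by blast+
    then show "k \<in> {\<lfloor>- u / b\<rfloor>..\<lceil>(c - u) / b\<rceil>}"
      by simp linarith
  qed
  then have fin: "finite K"
    by (rule finite_subset) simp
  have "Mmult a b c t x j = (\<Sum>k\<in>K. x k)"
    unfolding Mmult_def by (rule sum.cong) (auto simp: K_def u_def Mentry_def)
  also have "\<dots> = (\<Sum>k\<in>K. of_bool (x k = 1))"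
    by (rule sum.cong) (use assms(2) in auto)
  also have "\<dots> = of_nat (card (K \<inter> {k. x k = 1}))"
    using fin by simp
  finally have "Mmult a b c t x j = 1 \<longleftrightarrow> card (K \<inter> {k. x k = 1}) = 1"
    by simp
  also have "\<dots> \<longleftrightarrow> (\<exists>!k. k \<in> K \<inter> {k. x k = 1})"
    unfolding One_nat_def card_1_singleton_iff set_eq_iff singleton_iff by metis
  finally show ?thesis
    by (simp add: K_def u_def)
qed

definition window_tiling :: "real \<Rightarrow> real \<Rightarrow> real \<Rightarrow> real set \<Rightarrow> bool" where
  "window_tiling a b c T \<longleftrightarrow> (\<forall>x\<in>T. \<forall>y\<in>T. y - x \<in> lattice b) \<and>
    (\<forall>j::int. \<exists>!x. x \<in> T \<and> a * of_int j \<le> x \<and> x < a * of_int j + c)"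

lemma window_tiling_of_solution:
  assumes "0 < b" "\<And>k. x k \<in> {0, 1}" "\<And>j. Mmult a b c t x j = 1"
  shows "window_tiling a b c {t + b * of_int k | k. x k = 1}"
  unfolding window_tiling_def
proof (intro conjI ballI allI)
  fix y z assume "y \<in> {t + b * of_int k | k. x k = 1}" "z \<in> {t + b * of_int k | k. x k = 1}"
  then obtain i j :: int where "y = t + b * of_int i" "z = t + b * of_int j"
    by blast
  then have "z - y = b * of_int (j - i)"
    by (simp add: algebra_simps)
  then show "z - y \<in> lattice b"
    unfolding lattice_def by blast
next
  fix j :: int
  have "t - a * of_int j + b * of_int k \<in> {0..<c} \<longleftrightarrow>
      a * of_int j \<le> t + b * of_int k \<and> t + b * of_int k < a * of_int j + c" for k
    by auto
  then show "\<exists>!y. y \<in> {t + b * of_int k | k. x k = 1} \<and> a * of_int j \<le> y \<and> y < a * of_int j + c"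
    using assms(3)[of j] unfolding Mmult_eq_1_iff[OF assms(1,2)] by blast
qed

lemma solution_of_window_tiling:
  assumes "0 < b" "window_tiling a b c T" "t \<in> T"
  shows "Mmult a b c t (\<lambda>k. of_bool (t + b * of_int k \<in> T)) j = 1"
proof -
  obtain y where y: "y \<in> T" "a * of_int j \<le> y" "y < a * of_int j + c"
    and unique: "\<And>z. z \<in> T \<Longrightarrow> a * of_int j \<le> z \<Longrightarrow> z < a * of_int j + c \<Longrightarrow> z = y"
    using assms(2) unfolding window_tiling_def by metis
  obtain k :: int where k: "y = t + b * of_int k"
    using assms(2,3) y(1) unfolding window_tiling_def lattice_def by (force simp: algebra_simps)
  have "\<exists>!k. t - a * of_int j + b * of_int k \<in> {0..<c} \<and>
      of_bool (t + b * of_int k \<in> T) = (1::real)"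
  proof (rule ex1I)
    show "t - a * of_int j + b * of_int k \<in> {0..<c} \<and> of_bool (t + b * of_int k \<in> T) = (1::real)"
      using y unfolding k by simp
  next
    fix i
    assume "t - a * of_int j + b * of_int i \<in> {0..<c} \<and> of_bool (t + b * of_int i \<in> T) = (1::real)"
    then have "t + b * of_int i = y"
      by (intro unique) auto
    then show "i = k"
      using assms(1) unfolding k by simp
  qed
  then show ?thesis
    by (subst Mmult_eq_1_iff[OF assms(1)]) auto
qed

lemma S_set_nonempty_iff_window_tiling:
  assumes "0 < b"
  shows "S_set a b c \<noteq> {} \<longleftrightarrow> (\<exists>T. window_tiling a b c T)"
proof
  assume "S_set a b c \<noteq> {}"
  then obtain t x where "x \<in> B0" "\<And>j. Mmult a b c t x j = 1"
    unfolding S_set_def by blast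
  then show "\<exists>T. window_tiling a b c T"
    using window_tiling_of_solution[OF assms, of x] unfolding B0_def by blast
next
  assume "\<exists>T. window_tiling a b c T"
  then obtain T where T: "window_tiling a b c T"
    by blast
  then obtain t where "t \<in> T"
    unfolding window_tiling_def by metis
  moreover from this have "(\<lambda>k. of_bool (t + b * of_int k \<in> T)) \<in> B0"
    by (auto simp: B0_def)
  ultimately have "t \<in> S_set a b c"
    using solution_of_window_tiling[OF assms T] unfolding S_set_def by blast
  then show "S_set a b c \<noteq> {}"
    by blast
qed

lemma window_iff:
  fixes a c x :: real
  assumes "0 < a"
  shows "a * of_int j \<le> x \<and> x < a * of_int j + c \<longleftrightarrow> \<lfloor>(x - c) / a\<rfloor> < j \<and> j \<le> \<lfloor>x / a\<rfloor>"
proof -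
  have "\<not> j \<le> \<lfloor>(x - c) / a\<rfloor> \<longleftrightarrow> x < a * of_int j + c"
    unfolding le_floor_divide_iff[OF assms] by auto
  then show ?thesis
    unfolding le_floor_divide_iff[OF assms, of j x] by auto
qed

lemma window_nonempty:
  fixes a c x :: real
  assumes "0 < a" "a < c"
  shows "\<lfloor>(x - c) / a\<rfloor> < \<lfloor>x / a\<rfloor>"
proof -
  have "(x - c) / a + 1 \<le> x / a"
    using assms by (simp add: field_simps)
  then show ?thesis
    by linarith
qed

lemma window_tiling_ex1:
  assumes "0 < a" "window_tiling a b c T"
  shows "\<exists>!x. x \<in> T \<and> \<lfloor>(x - c) / a\<rfloor> < j \<and> j \<le> \<lfloor>x / a\<rfloor>"
  using assms(2) unfolding window_tiling_def window_iff[OF assms(1)] by blast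

lemma window_tiling_next:
  assumes "0 < a" "a < c" "window_tiling a b c T" "x \<in> T"
  shows "\<exists>y\<in>T. \<lfloor>(y - c) / a\<rfloor> = \<lfloor>x / a\<rfloor>"
proof -
  note ex1 = window_tiling_ex1[OF assms(1,3)]
  obtain y where y: "y \<in> T" "\<lfloor>(y - c) / a\<rfloor> < \<lfloor>x / a\<rfloor> + 1" "\<lfloor>x / a\<rfloor> + 1 \<le> \<lfloor>y / a\<rfloor>"
    using ex1 by blast
  have "\<not> \<lfloor>(y - c) / a\<rfloor> < \<lfloor>x / a\<rfloor>"
  proof
    assume "\<lfloor>(y - c) / a\<rfloor> < \<lfloor>x / a\<rfloor>"
    then have "x = y"
      using ex1[of "\<lfloor>x / a\<rfloor>"] y assms(4) window_nonempty[OF assms(1,2), of x] by auto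
    then show False
      using y(3) by simp
  qed
  then show ?thesis
    using y(1,2) by (intro bexI[of _ y]) auto
qed

lemma window_tiling_previous:
  assumes "0 < a" "a < c" "window_tiling a b c T" "y \<in> T"
  shows "\<exists>x\<in>T. \<lfloor>(y - c) / a\<rfloor> = \<lfloor>x / a\<rfloor>"
proof -
  note ex1 = window_tiling_ex1[OF assms(1,3)]
  obtain x where x: "x \<in> T" "\<lfloor>(x - c) / a\<rfloor> < \<lfloor>(y - c) / a\<rfloor>" "\<lfloor>(y - c) / a\<rfloor> \<le> \<lfloor>x / a\<rfloor>"
    using ex1 by blast
  have "\<not> \<lfloor>(y - c) / a\<rfloor> < \<lfloor>x / a\<rfloor>"
  proof
    assume "\<lfloor>(y - c) / a\<rfloor> < \<lfloor>x / a\<rfloor>"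
    then have "x = y"
      using ex1[of "\<lfloor>(y - c) / a\<rfloor> + 1"] x assms(4) window_nonempty[OF assms(1,2), of y] by auto
    then show False
      using x(2) by simp
  qed
  then show ?thesis
    using x by (intro bexI[of _ x]) auto
qed

lemma int_increasing_bracket:
  fixes f :: "int \<Rightarrow> int"
  assumes "\<And>i. f i < f (i + 1)"
  shows "\<exists>!i. f (i - 1) < j \<and> j \<le> f i"
proof -
  have growth: "f i + (m - i) \<le> f m" if "i \<le> m" for i m
    using that
  proof (induction m rule: int_ge_induct)
    case (step m)
    then show ?case
      using assms[of m] by simp
  qed simp
  have crossing: "\<exists>i. f (i - 1) < j \<and> j \<le> f i" if "f m < j" "j \<le> f (m + int n)" for m n
    using that(2)
  proof (induction n)
    case (Suc n)
    show ?case
    proof (cases "j \<le> f (m + int n)")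
      case False
      then show ?thesis
        using Suc.prems by (intro exI[of _ "m + int (Suc n)"]) (simp add: algebra_simps)
    qed (rule Suc.IH)
  qed (use that(1) in simp)
  define m where "m = - \<bar>f 0 - j\<bar> - 1"
  then have "m \<le> 0" "f 0 + m < j"
    by linarith+
  then have "f m < j"
    using growth[of m 0] by simp
  moreover from this have "j \<le> f (m + int (nat (j - f m)))"
    using growth[of m "m + int (nat (j - f m))"] by simp
  ultimately have "\<exists>i. f (i - 1) < j \<and> j \<le> f i"
    by (rule crossing)
  moreover have "i = i'" if "f (i - 1) < j \<and> j \<le> f i" "f (i' - 1) < j \<and> j \<le> f i'" for i i'
    using that growth[of i "i' - 1"] growth[of i' "i - 1"] by linarith
  ultimately show ?thesis
    by blast
qed

lemma window_tiling_range:
  fixes \<tau> :: "int \<Rightarrow> real"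
  assumes "0 < a" "a < c" "\<And>i j. \<tau> j - \<tau> i \<in> lattice b"
    and next_window: "\<And>i. \<lfloor>(\<tau> (i + 1) - c) / a\<rfloor> = \<lfloor>\<tau> i / a\<rfloor>"
  shows "window_tiling a b c (range \<tau>)"
  unfolding window_tiling_def window_iff[OF assms(1)]
proof (intro conjI allI)
  fix j :: int
  have "\<lfloor>\<tau> i / a\<rfloor> < \<lfloor>\<tau> (i + 1) / a\<rfloor>" for i
    using window_nonempty[OF assms(1,2), of "\<tau> (i + 1)"] by (simp add: next_window)
  then have "\<exists>!i. \<lfloor>\<tau> (i - 1) / a\<rfloor> < j \<and> j \<le> \<lfloor>\<tau> i / a\<rfloor>"
    by (rule int_increasing_bracket)
  moreover have "\<lfloor>\<tau> (i - 1) / a\<rfloor> = \<lfloor>(\<tau> i - c) / a\<rfloor>" for i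
    using next_window[of "i - 1"] by simp
  ultimately show "\<exists>!x. x \<in> range \<tau> \<and> \<lfloor>(x - c) / a\<rfloor> < j \<and> j \<le> \<lfloor>x / a\<rfloor>"
    by (metis rangeE rangeI)
qed (use assms(3) in blast)

section \<open>The successor map of a tiling\<close>

locale abc_parameters =
  fixes a b c :: real
  assumes a_pos: "0 < a" and a_less_b: "a < b" and b_less_c: "b < c"
    and remainder_gt: "b - a < c - of_int \<lfloor>c / b\<rfloor> * b"
    and remainder_less: "c - of_int \<lfloor>c / b\<rfloor> * b < a"
    and irrational: "a / b \<notin> \<rat>"
begin

definition N :: int where "N = \<lfloor>c / b\<rfloor>"

definition c0 :: real where "c0 = c - of_int N * b"

definition c1 :: real where "c1 = c - c0 - of_int \<lfloor>(c - c0) / a\<rfloor> * a"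

definition \<delta> :: real where "\<delta> = b - a"

definition p :: int where "p = N - \<lfloor>(c - c0) / a\<rfloor>"

abbreviation hole :: "real set" where "hole \<equiv> {c0 - \<delta>..<c0}"

definition F :: "real \<Rightarrow> real" where
  "F s = s + c1 + \<delta> * of_bool (s rmod a < c0)"

definition successor :: "real \<Rightarrow> real" where
  "successor s = s + b * of_int (N + of_bool (s rmod a < c0))"

lemma \<delta>_pos: "0 < \<delta>"
  using a_less_b by (simp add: \<delta>_def)

lemma \<delta>_less_c0: "\<delta> < c0"
  using remainder_gt by (simp add: \<delta>_def c0_def N_def)

lemma c0_less_a: "c0 < a"
  using remainder_less by (simp add: c0_def N_def)

lemma a_less_c: "a < c"
  using a_less_b b_less_c by simp

lemma N_pos: "0 < N"
  using a_pos a_less_b b_less_c by (simp add: N_def less_floor_iff)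

lemma c1_eq: "c1 = of_int N * \<delta> + a * of_int p"
  by (simp add: c1_def c0_def \<delta>_def p_def algebra_simps)

lemma rmod_a_nonneg [simp]: "0 \<le> s rmod a"
  using a_pos by (simp add: rmod_nonneg)

lemma rmod_a_less [simp]: "s rmod a < a"
  using a_pos by (simp add: rmod_less)

lemma \<delta>_multiple_in_lattice:
  assumes "of_int i * \<delta> = a * of_int j"
  shows "i = 0" "j = 0"
proof -
  show "i = 0"
  proof (rule ccontr)
    assume "i \<noteq> 0"
    have eq: "a * of_int (i + j) = of_int i * b"
      using assms by (simp add: \<delta>_def algebra_simps)
    moreover have "of_int i * b \<noteq> 0"
      using \<open>i \<noteq> 0\<close> a_pos a_less_b by simp
    ultimately have "real_of_int (i + j) \<noteq> 0"
      by (metis mult_zero_right)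
    then have "a / b = of_int i / of_int (i + j)"
      using eq a_pos a_less_b by (simp add: field_simps)
    then show False
      using irrational by simp
  qed
  then show "j = 0"
    using assms a_pos by simp
qed

lemma successor_eq_F: "successor s = F s + a * of_int (N - p + of_bool (s rmod a < c0))"
  by (simp add: successor_def F_def c1_eq \<delta>_def algebra_simps)

lemma F_add_multiple: "F (s + a * of_int j) = F s + a * of_int j"
  by (simp add: F_def)

text \<open>By \<open>window_iff\<close>, the left-hand side says that the first window containing \<open>x + bi\<close> comes right
  after the last one containing \<open>x\<close>.\<close>

lemma next_window_iff_successor:
  "\<lfloor>(x + b * of_int i - c) / a\<rfloor> = \<lfloor>x / a\<rfloor> \<longleftrightarrow> x rmod a \<notin> hole \<and> x + b * of_int i = successor x"
proof -
  define u where "u = x rmod a"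
  define m where "m = i - N"
  have u: "0 \<le> u" "u < a" and b: "b = a + \<delta>" "0 < b"
    using a_pos a_less_b by (simp_all add: u_def \<delta>_def)
  have "x + b * of_int i - c - a * of_int \<lfloor>x / a\<rfloor> = u + b * of_int m - c0"
    using rmod_add_floor[OF a_pos, of x] by (simp add: u_def m_def c0_def algebra_simps)
  then have window: "\<lfloor>(x + b * of_int i - c) / a\<rfloor> = \<lfloor>x / a\<rfloor> \<longleftrightarrow>
      c0 \<le> u + b * of_int m \<and> u + b * of_int m < c0 + a"
    unfolding floor_divide_eq_iff[OF a_pos] by auto
  have "x + b * of_int i = successor x \<longleftrightarrow> i = N + of_bool (u < c0)"
    unfolding successor_def u_def using b(2) by (simp del: of_int_add)
  then have is_successor: "x + b * of_int i = successor x \<longleftrightarrow> m = of_bool (u < c0)"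
    by (auto simp: m_def)
  consider (negative) "m \<le> -1" | (zero) "m = 0" | (one) "m = 1" | (large) "2 \<le> m"
    by linarith
  then show ?thesis
  proof cases
    case negative
    then have "b * of_int m \<le> b * (-1)"
      using b(2) by (intro mult_left_mono) linarith+
    then show ?thesis
      unfolding window is_successor using negative u \<delta>_less_c0 \<delta>_pos b by auto
  next
    case large
    then have "b * 2 \<le> b * of_int m"
      using b(2) by (intro mult_left_mono) linarith+
    then have "c0 + a < b * of_int m"
      using c0_less_a a_less_b by linarith
    then show ?thesis
      unfolding window is_successor using large u(1) by auto
  qed (unfold window is_successor u_def[symmetric], use u b c0_less_a \<delta>_less_c0 \<delta>_pos in auto)
qed

lemma window_tiling_successor_closed:
  assumes "window_tiling a b c T" "x \<in> T"
  shows "x rmod a \<notin> hole" "successor x \<in> T"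
proof -
  obtain y where y: "y \<in> T" "\<lfloor>(y - c) / a\<rfloor> = \<lfloor>x / a\<rfloor>"
    using window_tiling_next[OF a_pos a_less_c assms] by blast
  then obtain i :: int where "y = x + b * of_int i"
    using assms unfolding window_tiling_def lattice_def by (force simp: algebra_simps)
  then have "x rmod a \<notin> hole \<and> y = successor x"
    using y(2) next_window_iff_successor by simp
  then show "x rmod a \<notin> hole" "successor x \<in> T"
    using y(1) by simp_all
qed

lemma window_tiling_ex_predecessor:
  assumes "window_tiling a b c T" "y \<in> T"
  shows "\<exists>x\<in>T. successor x = y"
proof -
  obtain x where x: "x \<in> T" "\<lfloor>(y - c) / a\<rfloor> = \<lfloor>x / a\<rfloor>"
    using window_tiling_previous[OF a_pos a_less_c assms] by blast
  then obtain i :: int where "y = x + b * of_int i"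
    using assms unfolding window_tiling_def lattice_def by (force simp: algebra_simps)
  then have "y = successor x"
    using x(2) next_window_iff_successor by simp
  then show ?thesis
    using x(1) by blast
qed

lemma F_strict_mono:
  assumes "r rmod a \<notin> hole" "s rmod a \<notin> hole" "r < s"
  shows "F r < F s"
proof (cases "r rmod a < c0 \<and> \<not> s rmod a < c0")
  case True
  have "a * of_int \<lfloor>r / a\<rfloor> \<le> a * of_int \<lfloor>s / a\<rfloor>"
    using assms(3) a_pos by (simp add: floor_mono divide_right_mono)
  then have "s rmod a - r rmod a \<le> s - r"
    using rmod_add_floor[OF a_pos, of r] rmod_add_floor[OF a_pos, of s] by linarith
  moreover have "\<delta> < s rmod a - r rmod a"
    using True assms(1) by auto
  ultimately show ?thesis
    using True by (simp add: F_def)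
next
  case False
  then show ?thesis
    using assms(3) \<delta>_pos by (auto simp: F_def)
qed

lemma F_less_iff:
  assumes "r rmod a \<notin> hole" "s rmod a \<notin> hole"
  shows "F r < F s \<longleftrightarrow> r < s"
  using F_strict_mono[of r s] F_strict_mono[of s r] assms by (cases r s rule: linorder_cases) auto

lemma ex_funpow_F_displacement: "\<exists>e :: nat. (F ^^ n) r = r + of_nat n * c1 + \<delta> * of_nat e"
proof (induction n)
  case 0
  show ?case
    by (rule exI[of _ 0]) simp
next
  case (Suc n)
  then obtain e :: nat where e: "(F ^^ n) r = r + of_nat n * c1 + \<delta> * of_nat e"
    by blast
  have "(F ^^ Suc n) r
      = r + of_nat (Suc n) * c1 + \<delta> * of_nat (e + of_bool ((F ^^ n) r rmod a < c0))"
    using F_def[of "(F ^^ n) r"] by (simp add: e algebra_simps)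
  then show ?case
    by blast
qed

lemma funpow_F_not_periodic:
  assumes "n \<noteq> m"
  shows "(F ^^ n) r rmod a \<noteq> (F ^^ m) r rmod a"
  using assms
proof (induction n m rule: linorder_wlog)
  case (le m n)
  show ?case
  proof
    assume "(F ^^ m) r rmod a = (F ^^ n) r rmod a"
    then obtain j where j: "(F ^^ n) r = (F ^^ m) r + of_int j * a"
      using rcong_altdef by (auto simp: rcong_def)
    have "(F ^^ n) r = (F ^^ (n - m)) ((F ^^ m) r)"
      using funpow_add[of "n - m" m F] le by simp
    then obtain e :: nat where "(F ^^ n) r = (F ^^ m) r + of_nat (n - m) * c1 + \<delta> * of_nat e"
      using ex_funpow_F_displacement[of "n - m" "(F ^^ m) r"] by auto
    with j have "of_int (int (n - m) * N + int e) * \<delta> = a * of_int (j - int (n - m) * p)"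
      by (simp add: c1_eq algebra_simps)
    then have "int (n - m) * N + int e = 0"
      by (rule \<delta>_multiple_in_lattice(1))
    moreover have "0 < int (n - m) * N"
      using le N_pos by simp
    ultimately show False
      by linarith
  qed
next
  case (sym m n)
  from sym(1)[OF not_sym[OF sym(2)]] show ?case
    by (rule not_sym)
qed

lemma rmod_a_lower_right_constant:
  "\<exists>s>r. \<forall>x. r \<le> x \<and> x < s \<longrightarrow> (x rmod a < c0 \<longleftrightarrow> r rmod a < c0)"
proof (intro exI conjI allI impI)
  let ?t = "if r rmod a < c0 then c0 else a"
  show "r < r + (?t - r rmod a)"
    by simp
  fix x assume x: "r \<le> x \<and> x < r + (?t - r rmod a)"
  have "(r + (x - r)) rmod a = r rmod a + (x - r)"
    by (rule rmod_translate) (use x a_pos c0_less_a in \<open>auto split: if_splits\<close>)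
  then show "x rmod a < c0 \<longleftrightarrow> r rmod a < c0"
    using x by (auto split: if_splits)
qed

end

section \<open>Gaps of an invariant set\<close>

locale F_invariant = abc_parameters +
  fixes P :: "real set"
  assumes nonempty: "P \<noteq> {}"
    and periodic: "\<And>x j. x \<in> P \<Longrightarrow> x + a * of_int j \<in> P"
    and avoids_hole: "\<And>x. x \<in> P \<Longrightarrow> x rmod a \<notin> hole"
    and F_image: "\<And>x. x \<in> P \<Longrightarrow> F x \<in> P"
    and F_preimage: "\<And>y. y \<in> P \<Longrightarrow> \<exists>x\<in>P. F x = y"

lemma (in abc_parameters) F_invariant_of_window_tiling:
  assumes T: "window_tiling a b c T"
  shows "F_invariant a b c {y + a * of_int j | y j. y \<in> T}" (is "F_invariant a b c ?P")
proof
  have mem: "y + a * of_int j + a * of_int i \<in> ?P" if "y \<in> T" for y i j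
  proof -
    have "y + a * of_int j + a * of_int i = y + a * of_int (j + i)"
      by (simp add: algebra_simps)
    then show ?thesis
      using that by blast
  qed
  show "?P \<noteq> {}"
    using T unfolding window_tiling_def by blast
  show "x + a * of_int i \<in> ?P" if "x \<in> ?P" for x i
    using that mem by blast
  show "x rmod a \<notin> hole" if "x \<in> ?P" for x
    using that window_tiling_successor_closed(1)[OF T] by auto
  have F_eq: "F (y + a * of_int j)
      = successor y + a * of_int (j - (N - p + of_bool (y rmod a < c0)))" for y j
    by (simp add: F_add_multiple successor_eq_F algebra_simps)
  show "F x \<in> ?P" if "x \<in> ?P" for x
    using that window_tiling_successor_closed(2)[OF T] F_eq by blast
  show "\<exists>x\<in>?P. F x = y" if y: "y \<in> ?P" for y
  proof -
    obtain z j where "z \<in> T" "y = z + a * of_int j"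
      using y by blast
    moreover obtain x where x: "x \<in> T" "successor x = z"
      using window_tiling_ex_predecessor[OF T \<open>z \<in> T\<close>] by blast
    ultimately have "F (x + a * of_int (j + (N - p + of_bool (x rmod a < c0)))) = y"
      unfolding F_eq by simp
    then show ?thesis
      using x(1) by blast
  qed
qed

context F_invariant begin

lemma ex_above: "\<exists>x\<in>P. s \<le> x"
proof -
  obtain x where x: "x \<in> P"
    using nonempty by blast
  obtain n :: nat where "(s - x) / a < of_nat n"
    using reals_Archimedean2 by blast
  then have "s \<le> x + a * of_int (int n)"
    using a_pos by (simp add: pos_divide_less_eq mult.commute)
  then show ?thesis
    using periodic[OF x] by blast
qed

lemma right_adherent_add_multiple:
  assumes "right_adherent P r"
  shows "right_adherent P (r + a * of_int j)"
  unfolding right_adherent_def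
proof (intro allI impI)
  fix s assume "r + a * of_int j < s"
  then have "r < s - a * of_int j"
    by simp
  then obtain x where "x \<in> P" "r \<le> x" "x < s - a * of_int j"
    using assms unfolding right_adherent_def by blast
  then show "\<exists>x\<in>P. r + a * of_int j \<le> x \<and> x < s"
    by (intro bexI[of _ "x + a * of_int j"] periodic) auto
qed

lemma gap_below_add_multiple:
  assumes "gap_below P r \<gamma>"
  shows "gap_below P (r + a * of_int j) \<gamma>"
  unfolding gap_below_def
proof (intro ballI impI)
  fix x assume "x \<in> P" "x < r + a * of_int j"
  then have "x + a * of_int (- j) \<in> P" "x + a * of_int (- j) < r"
    using periodic[of x "- j"] by auto
  then show "x \<le> r + a * of_int j - \<gamma>"
    using assms unfolding gap_below_def by force
qed

lemma gap_below_rmod_cong: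
  assumes "gap_below P r \<gamma>" "r rmod a = s rmod a"
  shows "gap_below P s \<gamma>"
proof -
  obtain j where "s = r + a * of_int j"
    using assms(2) rcong_altdef[of r s a] by (auto simp: rcong_def mult.commute)
  then show ?thesis
    using gap_below_add_multiple[OF assms(1)] by simp
qed

lemma right_adherent_avoids_hole:
  assumes "right_adherent P r"
  shows "r rmod a \<notin> hole"
proof
  assume hole: "r rmod a \<in> hole"
  then have "r < r + (c0 - r rmod a)"
    by simp
  then obtain x where x: "x \<in> P" "r \<le> x" "x < r + (c0 - r rmod a)"
    using assms unfolding right_adherent_def by blast
  have "(r + (x - r)) rmod a = r rmod a + (x - r)"
    by (rule rmod_translate) (use x a_pos c0_less_a in auto)
  then show False
    using avoids_hole[OF x(1)] x hole by auto
qed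

lemma right_adherent_same_side:
  assumes "right_adherent P r" "r < s"
  shows "\<exists>x\<in>P. r \<le> x \<and> x < s \<and> (x rmod a < c0 \<longleftrightarrow> r rmod a < c0)"
proof -
  obtain s' where s': "r < s'" "\<And>x. r \<le> x \<Longrightarrow> x < s' \<Longrightarrow> x rmod a < c0 \<longleftrightarrow> r rmod a < c0"
    using rmod_a_lower_right_constant[of r] by blast
  then have "r < min s s'"
    using assms(2) by simp
  then obtain x where x: "x \<in> P" "r \<le> x" "x < min s s'"
    using assms(1) unfolding right_adherent_def by blast
  then have "x rmod a < c0 \<longleftrightarrow> r rmod a < c0"
    by (intro s'(2)) auto
  then show ?thesis
    using x by auto
qed

lemma right_adherent_F:
  assumes "right_adherent P r"
  shows "right_adherent P (F r)"
  unfolding right_adherent_def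
proof (intro allI impI)
  fix s assume "F r < s"
  then have "r < r + (s - F r)"
    by simp
  then obtain x where x: "x \<in> P" "r \<le> x" "x < r + (s - F r)" "x rmod a < c0 \<longleftrightarrow> r rmod a < c0"
    using right_adherent_same_side[OF assms] by blast
  then have "F r \<le> F x" "F x < s"
    by (simp_all add: F_def)
  then show "\<exists>x\<in>P. F r \<le> x \<and> x < s"
    using F_image[OF x(1)] by blast
qed

lemma right_adherent_funpow_F: "right_adherent P r \<Longrightarrow> right_adherent P ((F ^^ n) r)"
  by (induction n) (simp_all add: right_adherent_F)

text \<open>A point of \<open>P\<close> below \<open>F r\<close> is \<open>F x\<close> with \<open>x < r\<close>, and by monotonicity any point \<open>q\<close> of \<open>P\<close>
  between \<open>x\<close> and \<open>r\<close> can stand in for \<open>x\<close>.\<close>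

lemma gap_below_F:
  assumes "right_adherent P r" "gap_below P r \<gamma>"
    and "\<And>x. x \<in> P \<Longrightarrow> x < r \<Longrightarrow> \<exists>q\<in>P. x \<le> q \<and> q < r \<and> F q - q + e \<le> F r - r"
  shows "gap_below P (F r) (\<gamma> + e)"
  unfolding gap_below_def
proof (intro ballI impI)
  fix y assume y: "y \<in> P" "y < F r"
  then obtain x where x: "x \<in> P" "F x = y"
    using F_preimage by blast
  then have "x < r"
    using F_less_iff[OF avoids_hole right_adherent_avoids_hole[OF assms(1)]] y by blast
  then obtain q where q: "q \<in> P" "x \<le> q" "q < r" "F q - q + e \<le> F r - r"
    using assms(3) x(1) by blast
  have "F x \<le> F q"
    using F_strict_mono[of x q] avoids_hole x(1) q(1,2) by (cases "x = q") auto
  moreover have "q \<le> r - \<gamma>"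
    using assms(2) q(1,3) unfolding gap_below_def by blast
  ultimately show "y \<le> F r - (\<gamma> + e)"
    using q(4) x(2) by linarith
qed

lemma rmod_separated_by_gap:
  assumes "right_adherent P r" "gap_below P s \<gamma>" "r rmod a < s rmod a"
  shows "r rmod a + \<gamma> \<le> s rmod a"
proof -
  let ?j = "\<lfloor>s / a\<rfloor> - \<lfloor>r / a\<rfloor>"
  have eq: "r + a * of_int ?j = s - s rmod a + r rmod a"
    using rmod_add_floor[OF a_pos, of r] rmod_add_floor[OF a_pos, of s] by (simp add: algebra_simps)
  have "r + a * of_int ?j \<le> s - \<gamma>"
    by (rule right_adherent_le_gap_below[OF right_adherent_add_multiple[OF assms(1)] assms(2)])
      (use assms(3) eq in simp)
  then show ?thesis
    unfolding eq by simp
qed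

text \<open>Infinitely many gaps of a fixed size do not fit into a circle.\<close>

lemma not_all_gaps_below_orbit:
  assumes "right_adherent P r" "0 < \<epsilon>"
  shows "\<exists>n\<ge>m. \<not> gap_below P ((F ^^ n) r) \<epsilon>"
proof (rule ccontr)
  assume "\<not> ?thesis"
  then have gap: "gap_below P ((F ^^ n) r) \<epsilon>" if "m \<le> n" for n
    using that by blast
  obtain k :: nat where k: "a + \<epsilon> < of_nat k * \<epsilon>"
    using reals_Archimedean3[OF assms(2)] by blast
  have "\<epsilon> * of_nat (card {m..<m + k}) \<le> a - (- \<epsilon>)"
  proof (rule packing_bound[where f = "\<lambda>n. (F ^^ n) r rmod a"])
    show "inj_on (\<lambda>n. (F ^^ n) r rmod a) {m..<m + k}"
      using funpow_F_not_periodic by (auto simp: inj_on_def)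
    show "(F ^^ i) r rmod a + \<epsilon> \<le> (F ^^ j) r rmod a"
      if "j \<in> {m..<m + k}" "(F ^^ i) r rmod a < (F ^^ j) r rmod a" for i j
      using rmod_separated_by_gap[OF right_adherent_funpow_F[OF assms(1)] gap] that by simp
  qed (use a_pos assms(2) less_imp_le[OF rmod_a_less] in auto)
  then show False
    using k by (simp add: mult.commute)
qed

lemma right_adherent_entry: "right_adherent P (entry_point P s)"
  using ex_above right_adherent_entry_point by blast

lemma entry_ge: "s \<le> entry_point P s"
  using ex_above entry_point_ge by blast

lemma gap_below_c0: "gap_below P c0 \<delta>"
  unfolding gap_below_def
proof (intro ballI impI)
  fix x assume x: "x \<in> P" "x < c0"
  have "x \<notin> hole"
  proof
    assume "x \<in> hole"
    then have "x rmod a = x"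
      using \<delta>_less_c0 c0_less_a a_pos by simp
    then show False
      using avoids_hole[OF x(1)] \<open>x \<in> hole\<close> by simp
  qed
  then show "x \<le> c0 - \<delta>"
    using x(2) by simp
qed

text \<open>If \<open>P\<close> stayed on one side of \<open>c0\<close>, then \<open>F\<close> would be a translation on \<open>P\<close> and the gap at the
  hole would persist for ever.\<close>

lemma meets_both_sides: "\<exists>x\<in>P. (x rmod a < c0) = side"
proof (rule ccontr)
  assume "\<not> ?thesis"
  then have P_side: "x rmod a < c0 \<longleftrightarrow> \<not> side" if "x \<in> P" for x
    using that by blast
  have adherent_side: "r rmod a < c0 \<longleftrightarrow> \<not> side" if "right_adherent P r" for r
    using right_adherent_same_side[OF that, of "r + 1"] P_side by auto
  define r where "r = entry_point P c0"
  have r: "right_adherent P r"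
    unfolding r_def by (rule right_adherent_entry)
  have "gap_below P ((F ^^ n) r) \<delta>" for n
  proof (induction n)
    case 0
    show ?case
      using gap_below_antimono[OF gap_below_entry_point[OF gap_below_c0]] entry_ge
      by (simp add: r_def)
  next
    case (Suc n)
    let ?s = "(F ^^ n) r"
    have s: "right_adherent P ?s"
      using r by (rule right_adherent_funpow_F)
    have "gap_below P (F ?s) (\<delta> + 0)"
    proof (rule gap_below_F[OF s Suc])
      fix x assume "x \<in> P" "x < ?s"
      then show "\<exists>q\<in>P. x \<le> q \<and> q < ?s \<and> F q - q + 0 \<le> F ?s - ?s"
        using P_side adherent_side[OF s] by (intro bexI[of _ x]) (auto simp: F_def)
    qed
    then show ?case
      by simp
  qed
  then show False
    using not_all_gaps_below_orbit[OF r \<delta>_pos] by blast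
qed

text \<open>Modulo \<open>a\<close>, the displacement \<open>F s - s\<close> rises by \<open>\<delta>\<close> at \<open>0\<close> and drops by \<open>\<delta>\<close> at \<open>c0\<close>, so only the
  gaps below the following two points change their size.\<close>

definition start :: real where "start = entry_point P 0"

definition drop_point :: real where "drop_point = entry_point P c0"

lemma right_adherent_start: "right_adherent P start"
  unfolding start_def by (rule right_adherent_entry)

lemma rmod_a_mem: "x \<in> P \<Longrightarrow> x rmod a \<in> P"
  unfolding rmod_eq_add_multiple[OF a_pos] by (rule periodic)

lemma start_nonneg: "0 \<le> start"
  unfolding start_def by (rule entry_ge)

lemma start_less_c0: "start < c0"
proof -
  obtain x where x: "x \<in> P" "x rmod a < c0"
    using meets_both_sides[of True] by blast
  have "start \<le> x rmod a"
    unfolding start_def using rmod_a_mem[OF x(1)] by (rule entry_point_le) simp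
  then show ?thesis
    using x(2) by simp
qed

lemma c0_le_drop_point: "c0 \<le> drop_point"
  unfolding drop_point_def by (rule entry_ge)

lemma gap_below_start: "gap_below P start start"
proof -
  have "gap_below P 0 0"
    by (simp add: gap_below_def)
  from gap_below_entry_point[OF this] show ?thesis
    by (simp add: start_def)
qed

lemma gap_below_drop_point: "gap_below P drop_point (drop_point - c0 + \<delta>)"
  unfolding drop_point_def by (rule gap_below_entry_point[OF gap_below_c0])

lemma gap_below_F_start: "gap_below P (F start) (start + \<delta>)"
proof (rule gap_below_F[OF right_adherent_start gap_below_start])
  fix x assume x: "x \<in> P" "x < start"
  obtain z where z: "z \<in> P" "c0 \<le> z rmod a"
    using meets_both_sides[of False] by force
  define q where "q = max x (z rmod a - a)"
  have "z rmod a - a \<in> P"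
    using periodic[OF rmod_a_mem[OF z(1)], of "-1"] by simp
  moreover have "z rmod a - a < start"
    using start_nonneg rmod_a_less[of z] by linarith
  ultimately have q: "q \<in> P" "x \<le> q" "c0 - a \<le> q" "q < start"
    using x z(2) by (auto simp: q_def max_def)
  then have "q < 0"
    using entry_point_le[of q P 0] by (force simp: start_def)
  have "q rmod a = q + a"
    by (rule rmod_unique[of _ _ _ "-1"]) (use q(3) \<open>q < 0\<close> \<delta>_less_c0 \<delta>_pos a_pos in auto)
  then have "F q = q + c1"
    using q(3) by (simp add: F_def)
  moreover have "F start = start + c1 + \<delta>"
    using start_nonneg start_less_c0 c0_less_a by (simp add: F_def)
  ultimately show "\<exists>q\<in>P. x \<le> q \<and> q < start \<and> F q - q + \<delta> \<le> F start - start"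
    using q by (intro bexI[of _ q]) auto
qed

lemma ex_upper_point_below:
  assumes "right_adherent P r" "c0 \<le> r rmod a" "r rmod a \<noteq> drop_point rmod a"
  shows "\<exists>x\<in>P. x < r \<and> c0 \<le> r rmod a + (x - r)"
proof -
  have "drop_point \<le> r rmod a"
    unfolding drop_point_def using right_adherent_add_multiple[OF assms(1), of "- \<lfloor>r / a\<rfloor>"] assms(2)
    unfolding rmod_eq_add_multiple[OF a_pos, of r] by (rule entry_point_le_right_adherent)
  moreover have "drop_point \<noteq> r rmod a"
    using assms(3) by auto
  ultimately have "drop_point < r rmod a"
    by simp
  then obtain x where x: "x \<in> P" "drop_point \<le> x" "x < r rmod a"
    using right_adherent_entry[of c0] unfolding drop_point_def right_adherent_def by blast
  then show ?thesis
    using periodic[OF x(1), of "\<lfloor>r / a\<rfloor>"] rmod_add_floor[OF a_pos, of r] c0_le_drop_point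
    by (intro bexI[of _ "x + a * of_int \<lfloor>r / a\<rfloor>"]) auto
qed

lemma gap_below_F_persists:
  assumes "right_adherent P r" "gap_below P r \<gamma>" "r rmod a \<noteq> drop_point rmod a"
  shows "gap_below P (F r) \<gamma>"
proof -
  have "gap_below P (F r) (\<gamma> + 0)"
  proof (rule gap_below_F[OF assms(1,2)])
    fix x assume x: "x \<in> P" "x < r"
    show "\<exists>q\<in>P. x \<le> q \<and> q < r \<and> F q - q + 0 \<le> F r - r"
    proof (cases "r rmod a < c0")
      case True
      then show ?thesis
        using x \<delta>_pos by (intro bexI[of _ x]) (auto simp: F_def)
    next
      case False
      then obtain x0 where x0: "x0 \<in> P" "x0 < r" "c0 \<le> r rmod a + (x0 - r)"
        using ex_upper_point_below[OF assms(1) _ assms(3)] by auto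
      define q where "q = max x x0"
      have q: "q \<in> P" "x \<le> q" "q < r" "c0 \<le> r rmod a + (q - r)"
        using x x0 by (auto simp: q_def max_def)
      have "(r + (q - r)) rmod a = r rmod a + (q - r)"
        by (rule rmod_translate) (use q(3,4) rmod_a_less[of r] a_pos \<delta>_less_c0 \<delta>_pos in linarith)+
      then have "F q - q = F r - r"
        using q(4) False by (simp add: F_def)
      then show ?thesis
        using q by (intro bexI[of _ q]) auto
    qed
  qed
  then show ?thesis
    by simp
qed

lemma gap_below_F_shrinks:
  assumes "right_adherent P r" "gap_below P r \<gamma>"
  shows "gap_below P (F r) (\<gamma> - \<delta>)"
proof -
  have "gap_below P (F r) (\<gamma> + - \<delta>)"
  proof (rule gap_below_F[OF assms])
    fix x assume "x \<in> P" "x < r"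
    then show "\<exists>q\<in>P. x \<le> q \<and> q < r \<and> F q - q + - \<delta> \<le> F r - r"
      using \<delta>_pos by (intro bexI[of _ x]) (auto simp: F_def)
  qed
  then show ?thesis
    by simp
qed

lemma right_adherent_orbit: "right_adherent P ((F ^^ n) start)"
  by (rule right_adherent_funpow_F[OF right_adherent_start])

lemma gap_below_orbit_persists:
  assumes "gap_below P ((F ^^ m) start) \<gamma>"
    and "\<And>i. m \<le> i \<Longrightarrow> i < n \<Longrightarrow> (F ^^ i) start rmod a \<noteq> drop_point rmod a"
    and "m \<le> n"
  shows "gap_below P ((F ^^ n) start) \<gamma>"
  using assms(3,2)
proof (induction n rule: dec_induct)
  case (step n)
  then show ?case
    using gap_below_F_persists[OF right_adherent_orbit, of n \<gamma>] by simp
qed (rule assms(1))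

lemma ex_orbit_reaches_drop_point: "\<exists>D\<ge>1. (F ^^ D) start rmod a = drop_point rmod a"
proof (rule ccontr)
  assume "\<not> ?thesis"
  then have "gap_below P ((F ^^ n) start) (start + \<delta>)" if "1 \<le> n" for n
    using gap_below_orbit_persists[of 1 "start + \<delta>" n] gap_below_F_start that by simp
  moreover have "0 < start + \<delta>"
    using start_nonneg \<delta>_pos by simp
  ultimately show False
    using not_all_gaps_below_orbit[OF right_adherent_start, of "start + \<delta>" 1] by blast
qed

text \<open>What is left of a gap longer than \<open>\<delta>\<close> after shrinking would persist for ever.\<close>

lemma gap_below_orbit_at_drop_le:
  assumes "(F ^^ D) start rmod a = drop_point rmod a" "gap_below P ((F ^^ D) start) (\<gamma> + \<delta>)"
  shows "\<gamma> \<le> 0"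
proof (rule ccontr)
  assume "\<not> \<gamma> \<le> 0"
  then obtain n where n: "Suc D \<le> n" "\<not> gap_below P ((F ^^ n) start) \<gamma>"
    using not_all_gaps_below_orbit[OF right_adherent_start, of \<gamma> "Suc D"] by auto
  have "gap_below P ((F ^^ Suc D) start) \<gamma>"
    using gap_below_F_shrinks[OF right_adherent_orbit assms(2)] by simp
  moreover have "(F ^^ i) start rmod a \<noteq> drop_point rmod a" if "Suc D \<le> i" for i
    using funpow_F_not_periodic[of i D start] assms(1) that by simp
  ultimately show False
    using gap_below_orbit_persists n by blast
qed

lemma
  assumes "1 \<le> D" "(F ^^ D) start rmod a = drop_point rmod a"
  shows start_eq_0: "start = 0" and drop_point_eq_c0: "drop_point = c0"
    and gap_below_orbit: "\<And>n. 1 \<le> n \<Longrightarrow> n \<le> D \<Longrightarrow> gap_below P ((F ^^ n) start) \<delta>"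
proof -
  have gap: "gap_below P ((F ^^ n) start) (start + \<delta>)" if "1 \<le> n" "n \<le> D" for n
  proof (rule gap_below_orbit_persists[of 1])
    show "(F ^^ i) start rmod a \<noteq> drop_point rmod a" if "i < n" for i
      using funpow_F_not_periodic[of i D start] assms(2) that \<open>n \<le> D\<close> by simp
  qed (use gap_below_F_start that(1) in simp_all)
  then show "start = 0"
    using gap_below_orbit_at_drop_le[OF assms(2)] assms(1) start_nonneg by force
  then show "gap_below P ((F ^^ n) start) \<delta>" if "1 \<le> n" "n \<le> D" for n
    using gap that by simp
  have "gap_below P ((F ^^ D) start) (drop_point - c0 + \<delta>)"
    using gap_below_rmod_cong[OF gap_below_drop_point] assms(2) by simp
  then show "drop_point = c0"
    using gap_below_orbit_at_drop_le[OF assms(2)] c0_le_drop_point by force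
qed

end

section \<open>Collapsing a cycle of gaps\<close>

locale gap_cycle = abc_parameters +
  fixes D :: nat and k :: int
  assumes funpow_D: "(F ^^ D) 0 = c0 + a * of_int k"
    and cycle_avoids_hole: "\<And>n. n \<le> D \<Longrightarrow> (F ^^ n) 0 rmod a \<notin> hole"
    and cycle_separated: "\<And>i n. i \<le> D \<Longrightarrow> n \<le> D \<Longrightarrow> (F ^^ i) 0 rmod a < (F ^^ n) 0 rmod a \<Longrightarrow>
      (F ^^ i) 0 rmod a + \<delta> \<le> (F ^^ n) 0 rmod a"

lemma (in F_invariant) ex_gap_cycle: "\<exists>D k. gap_cycle a b c D k"
proof -
  obtain D where D: "1 \<le> D" "(F ^^ D) start rmod a = drop_point rmod a"
    using ex_orbit_reaches_drop_point by blast
  note start = start_eq_0[OF D]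
  have "c0 rmod a = c0"
    using \<delta>_pos \<delta>_less_c0 c0_less_a by simp
  have "gap_cycle a b c D \<lfloor>(F ^^ D) 0 / a\<rfloor>"
  proof
    show "(F ^^ D) 0 = c0 + a * of_int \<lfloor>(F ^^ D) 0 / a\<rfloor>"
      using rmod_add_floor[OF a_pos, of "(F ^^ D) 0"] D(2) \<open>c0 rmod a = c0\<close>
      by (simp add: start drop_point_eq_c0[OF D])
    show "(F ^^ n) 0 rmod a \<notin> hole" for n
      by (rule right_adherent_avoids_hole[OF right_adherent_orbit[unfolded start]])
    show "(F ^^ i) 0 rmod a + \<delta> \<le> (F ^^ n) 0 rmod a"
      if "n \<le> D" "(F ^^ i) 0 rmod a < (F ^^ n) 0 rmod a" for i n
    proof (rule rmod_separated_by_gap)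
      have "n \<noteq> 0"
        using that(2) rmod_a_nonneg[of "(F ^^ i) 0"] by (intro notI) (simp add: not_less[symmetric])
      then show "gap_below P ((F ^^ n) 0) \<delta>"
        using gap_below_orbit[OF D, of n] that(1) by (simp add: start)
    qed (use that(2) right_adherent_orbit[unfolded start] in simp_all)
  qed
  then show ?thesis
    by blast
qed

context abc_parameters begin

definition L :: "nat \<Rightarrow> real" where "L D = a - real D * \<delta>"

definition \<theta> :: "int \<Rightarrow> real" where "\<theta> k = c1 - of_int k * \<delta>"

definition l :: "nat \<Rightarrow> real" where "l d = c0 - (real d + 1) * \<delta>"

text \<open>Condition (1) says that \<open>m\<close> is an integer \<open>k\<close>, which reads \<open>D\<theta> = l + Lk\<close> in terms of the
  rotation.\<close>

definition admissible :: "nat \<Rightarrow> nat \<Rightarrow> int \<Rightarrow> bool" where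
  "admissible d1 d2 k \<longleftrightarrow> (let D = d1 + d2 + 1 in
     0 < l d1 \<and> l d1 < L D \<and> real D * \<theta> k = l d1 + L D * of_int k \<and>
     card {n \<in> {1..D}. (real n * \<theta> k) rmod L D < l d1} = d1)"

lemma rotation_not_periodic:
  assumes "0 < L D" "0 \<le> l d" "real D * \<theta> k = l d + L D * of_int k"
    and "of_int q * \<theta> k = L D * of_int j"
  shows "q = 0"
proof (rule ccontr)
  assume "q \<noteq> 0"
  have "of_int (q * (N - k) + j * int D) * \<delta> = a * of_int (j - q * p)"
    using assms(4) by (simp add: \<theta>_def L_def c1_eq algebra_simps)
  from \<delta>_multiple_in_lattice[OF this] have "q * (N - k + p * int D) = 0"
    by (simp add: algebra_simps)
  then have k: "k = N + p * int D"
    using \<open>q \<noteq> 0\<close> by simp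
  have "l d + L D * of_int N = 0"
    using assms(3) by (simp add: k \<theta>_def L_def c1_eq algebra_simps)
  moreover have "0 < L D * of_int N"
    using assms(1) N_pos by simp
  ultimately show False
    using assms(2) by simp
qed

end

context gap_cycle begin

definition orbit :: "nat \<Rightarrow> real" where "orbit n = (F ^^ n) 0"

definition residue :: "nat \<Rightarrow> real" where "residue n = orbit n rmod a"

definition collapsed :: "nat \<Rightarrow> real" where
  "collapsed n = residue n - \<delta> * real (card {i \<in> {1..D}. residue i \<le> residue n})"

definition d1 :: nat where "d1 = card {n \<in> {1..D}. residue n < c0}"

lemma residue_0: "residue 0 = 0"
  by (simp add: residue_def orbit_def)

lemma residue_D: "residue D = c0"
  using funpow_D \<delta>_pos \<delta>_less_c0 c0_less_a by (simp add: residue_def orbit_def)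

lemma residue_nonneg: "0 \<le> residue n"
  by (simp add: residue_def)

lemma residue_inj: "residue n = residue m \<Longrightarrow> n = m"
  using funpow_F_not_periodic by (auto simp: residue_def orbit_def)

lemma residue_eq_c0_iff: "residue n = c0 \<longleftrightarrow> n = D"
  using residue_inj[of n D] residue_D by auto

lemma residue_pos: "1 \<le> n \<Longrightarrow> 0 < residue n"
  using residue_inj[of n 0] residue_nonneg[of n] by (auto simp: residue_0 order_le_less)

lemma D_pos: "1 \<le> D"
proof (rule ccontr)
  assume "\<not> 1 \<le> D"
  then have "D = 0"
    by simp
  then show False
    using residue_0 residue_D \<delta>_pos \<delta>_less_c0 by simp
qed

lemma residue_separated:
  assumes "i \<le> D" "n \<le> D" "residue i < residue n"
  shows "residue i + \<delta> \<le> residue n"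
  using cycle_separated[OF assms(1,2)] assms(3) by (simp add: residue_def orbit_def)

lemma card_residues_between:
  assumes "i \<le> D" "residue i \<le> residue n"
  shows "\<delta> * real (card {j \<in> {1..D}. residue i < residue j \<and> residue j \<le> residue n})
    \<le> residue n - residue i" (is "\<delta> * real (card ?between) \<le> _")
proof (rule packing_bound[where f = residue])
  show "inj_on residue ?between"
    by (rule inj_onI) (rule residue_inj)
  show "residue j + \<delta> \<le> residue m"
    if "j \<in> ?between" "m \<in> ?between" "residue j < residue m" for j m
    using residue_separated[of j m] that by simp
  show "residue i + \<delta> \<le> residue j \<and> residue j \<le> residue n" if "j \<in> ?between" for j
    using residue_separated[of i j] assms(1) that by simp
qed (use assms(2) in simp_all)

lemma collapsed_mono:
  assumes "i \<le> D" "residue i \<le> residue n"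
  shows "collapsed i \<le> collapsed n"
proof -
  let ?upto = "\<lambda>n. {j \<in> {1..D}. residue j \<le> residue n}"
  let ?between = "{j \<in> {1..D}. residue i < residue j \<and> residue j \<le> residue n}"
  have split: "?upto n = ?upto i \<union> ?between"
    using assms(2) by auto
  have "card (?upto n) = card (?upto i) + card ?between"
    unfolding split by (rule card_Un_disjoint) auto
  then have "collapsed n - collapsed i = residue n - residue i - \<delta> * real (card ?between)"
    unfolding collapsed_def by (simp only: of_nat_add distrib_left)
  then show ?thesis
    using card_residues_between[OF assms] by simp
qed

lemma collapsed_0: "collapsed 0 = 0"
proof -
  have "{i \<in> {1..D}. residue i \<le> residue 0} = {}"
    using residue_pos by (force simp: residue_0)
  then show ?thesis
    unfolding collapsed_def by (simp only: residue_0) simp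
qed

lemma collapsed_nonneg: "0 \<le> collapsed n"
  using collapsed_mono[of 0 n] residue_nonneg by (simp add: collapsed_0 residue_0)

lemma collapsed_less:
  assumes "n \<le> D"
  shows "collapsed n < L D"
proof -
  have "Max (residue ` {..D}) \<in> residue ` {..D}"
    by (rule Max_in) auto
  then obtain m where "Max (residue ` {..D}) = residue m"
    by blast
  then have m: "residue i \<le> residue m" if "i \<le> D" for i
    using that by (metis Max_ge atMost_iff finite_atMost finite_imageI imageI)
  have "{i \<in> {1..D}. residue i \<le> residue m} = {1..D}"
    using m by auto
  then have "collapsed m = residue m - \<delta> * real D"
    by (simp add: collapsed_def)
  also have "\<dots> < L D"
    by (simp add: L_def residue_def mult.commute)
  finally show ?thesis
    using collapsed_mono[OF assms m[OF assms]] by simp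
qed

lemma card_residue_le_c0: "card {n \<in> {1..D}. residue n \<le> c0} = Suc d1"
proof -
  have "{n \<in> {1..D}. residue n \<le> c0} = insert D {n \<in> {1..D}. residue n < c0}"
    using residue_eq_c0_iff D_pos by (auto simp: order_le_less)
  then show ?thesis
    using residue_D by (simp add: d1_def)
qed

lemma d1_less_D: "d1 < D"
proof -
  have "card {n \<in> {1..D}. residue n \<le> c0} \<le> card {1..D}"
    by (rule card_mono) auto
  then show ?thesis
    unfolding card_residue_le_c0 by simp
qed

lemma collapsed_D: "collapsed D = l d1"
  unfolding collapsed_def residue_D card_residue_le_c0 by (simp add: l_def algebra_simps)

lemma floor_orbit_diff_Suc:
  assumes "n < D" "i < D"
  shows "\<lfloor>(orbit (Suc n) - orbit (Suc i)) / a\<rfloor> = \<lfloor>(orbit n - orbit i) / a\<rfloor>"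
proof -
  have "j \<le> \<lfloor>(orbit (Suc n) - orbit (Suc i)) / a\<rfloor> \<longleftrightarrow> j \<le> \<lfloor>(orbit n - orbit i) / a\<rfloor>" for j
  proof -
    have "F (orbit n) < F (orbit i + a * of_int j) \<longleftrightarrow> orbit n < orbit i + a * of_int j"
      by (rule F_less_iff) (use assms cycle_avoids_hole in \<open>simp_all add: orbit_def\<close>)
    then show ?thesis
      unfolding le_floor_divide_iff[OF a_pos] by (auto simp: orbit_def F_add_multiple)
  qed
  then show ?thesis
    by (meson antisym order_refl)
qed

lemma rotation_eq_orbit_minus_count:
  "n \<le> D \<Longrightarrow> real n * \<theta> k = orbit n - \<delta> * of_int (periodic_count a orbit D (orbit n))"
proof (induction n)
  case 0
  have "{i \<in> {1..D}. orbit i rmod a \<le> 0} = {}"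
    using residue_pos by (force simp: residue_def)
  then show ?case
    by (simp add: orbit_def periodic_count_def)
next
  case (Suc n)
  have "periodic_count a orbit D (orbit (Suc n))
      = periodic_count a orbit D (orbit n) + k + of_bool (orbit n rmod a < c0)"
    by (rule periodic_count_step)
      (use Suc.prems a_pos \<delta>_pos \<delta>_less_c0 c0_less_a floor_orbit_diff_Suc funpow_D
        in \<open>simp_all add: orbit_def\<close>)
  moreover have "orbit (Suc n) = F (orbit n)"
    by (simp add: orbit_def)
  ultimately show ?case
    using Suc by (simp add: F_def \<theta>_def algebra_simps)
qed

lemma rotation_eq_collapsed:
  assumes "n \<le> D"
  shows "real n * \<theta> k = collapsed n + L D * of_int \<lfloor>orbit n / a\<rfloor>"
proof -
  have "orbit n = residue n + a * of_int \<lfloor>orbit n / a\<rfloor>"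
    unfolding residue_def by (rule rmod_add_floor[OF a_pos, symmetric])
  moreover have "real n * \<theta> k = orbit n - \<delta> * (real D * of_int \<lfloor>orbit n / a\<rfloor>
      + real (card {i \<in> {1..D}. residue i \<le> residue n}))"
    using rotation_eq_orbit_minus_count[OF assms] by (simp add: periodic_count_def residue_def)
  ultimately show ?thesis
    unfolding collapsed_def L_def by argo
qed

lemma rotation_rmod:
  assumes "n \<le> D"
  shows "(real n * \<theta> k) rmod L D = collapsed n"
  unfolding rotation_eq_collapsed[OF assms] rmod_add_multiple
  using collapsed_nonneg[of n] collapsed_less[OF assms] by simp

lemma rotation_D: "real D * \<theta> k = l d1 + L D * of_int k"
proof -
  have "\<lfloor>orbit D / a\<rfloor> = k"
    using funpow_D \<delta>_pos \<delta>_less_c0 c0_less_a by (simp add: floor_divide_eq_iff[OF a_pos] orbit_def)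
  then show ?thesis
    using rotation_eq_collapsed[of D] by (simp add: collapsed_D)
qed

lemma collapsed_inj:
  assumes "n \<le> D" "m \<le> D" "collapsed n = collapsed m"
  shows "n = m"
proof -
  have "of_int (int n - int m) * \<theta> k = real n * \<theta> k - real m * \<theta> k"
    by (simp add: algebra_simps)
  also have "\<dots> = L D * of_int (\<lfloor>orbit n / a\<rfloor> - \<lfloor>orbit m / a\<rfloor>)"
    by (simp add: rotation_eq_collapsed assms algebra_simps)
  finally have "of_int (int n - int m) * \<theta> k = L D * of_int (\<lfloor>orbit n / a\<rfloor> - \<lfloor>orbit m / a\<rfloor>)" .
  moreover have "0 < L D" "0 \<le> l d1"
    using collapsed_nonneg[of D] collapsed_less[of D] by (simp_all add: collapsed_D)
  ultimately have "int n - int m = 0"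
    using rotation_not_periodic rotation_D by blast
  then show ?thesis
    by simp
qed

lemma collapsed_less_l_iff:
  assumes "n \<le> D"
  shows "collapsed n < l d1 \<longleftrightarrow> residue n < c0"
proof
  assume "residue n < c0"
  then have "collapsed n \<le> l d1" "n \<noteq> D"
    using collapsed_mono[OF assms, of D] by (auto simp: residue_D collapsed_D)
  then show "collapsed n < l d1"
    using collapsed_inj[OF assms, of D] by (auto simp: collapsed_D order_le_less)
next
  assume "collapsed n < l d1"
  then show "residue n < c0"
    using collapsed_mono[of D n] by (force simp: residue_D collapsed_D)
qed

lemma admissible: "admissible d1 (D - Suc d1) k"
proof -
  have D: "d1 + (D - Suc d1) + 1 = D"
    using d1_less_D by simp
  have "l d1 \<noteq> 0"
    using collapsed_inj[of D 0] D_pos by (auto simp: collapsed_D collapsed_0)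
  then have "0 < l d1" "l d1 < L D"
    using collapsed_nonneg[of D] collapsed_less[of D] by (simp_all add: collapsed_D)
  moreover have "{n \<in> {1..D}. (real n * \<theta> k) rmod L D < l d1} = {n \<in> {1..D}. residue n < c0}"
    using rotation_rmod collapsed_less_l_iff by auto
  ultimately show ?thesis
    unfolding admissible_def Let_def D using rotation_D by (simp add: d1_def)
qed

end

section \<open>Opening gaps in a rotation\<close>

locale admissible_rotation = abc_parameters +
  fixes d1 d2 :: nat and k :: int
  assumes admissible: "admissible d1 d2 k"
begin

abbreviation D :: nat where "D \<equiv> d1 + d2 + 1"

lemma l_pos: "0 < l d1"
  and l_less_L: "l d1 < L D"
  and rotation_D: "real D * \<theta> k = l d1 + L D * of_int k"
  and card_rotation: "card {n \<in> {1..D}. (real n * \<theta> k) rmod L D < l d1} = d1"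
  using admissible unfolding admissible_def Let_def by blast+

lemma L_pos: "0 < L D"
  using l_pos l_less_L by simp

lemma rotation_D_rmod: "(real D * \<theta> k) rmod L D = l d1"
  unfolding rotation_D rmod_add_multiple using l_pos l_less_L by simp

definition count :: "real \<Rightarrow> int" where
  "count = periodic_count (L D) (\<lambda>n. real n * \<theta> k) D"

definition opened :: "real \<Rightarrow> real" where "opened y = y + \<delta> * of_int (count y)"

definition points_below :: "real \<Rightarrow> nat set" where
  "points_below y = {n \<in> {1..D}. (real n * \<theta> k) rmod L D \<le> y rmod L D}"

lemma count_add_\<theta>: "count (y + \<theta> k) = count y + k + of_bool (y rmod L D < l d1)"
  unfolding count_def
  by (rule periodic_count_step)
    (use L_pos rotation_D l_pos l_less_L in \<open>simp_all add: algebra_simps\<close>)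

lemma opened_rmod: "opened y rmod a = y rmod L D + \<delta> * real (card (points_below y))"
proof (rule rmod_unique)
  show "opened y = y rmod L D + \<delta> * real (card (points_below y)) + of_int \<lfloor>y / L D\<rfloor> * a"
    using rmod_add_floor[OF L_pos, of y]
    by (simp add: opened_def count_def periodic_count_def points_below_def L_def algebra_simps)
  have "card (points_below y) \<le> card {1..D}"
    unfolding points_below_def by (rule card_mono) auto
  then have "\<delta> * real (card (points_below y)) \<le> \<delta> * real D"
    using \<delta>_pos by simp
  moreover have "y rmod L D < a - \<delta> * real D"
    using rmod_less[OF L_pos, of y] by (simp add: L_def mult.commute)
  moreover have "0 \<le> y rmod L D + \<delta> * real (card (points_below y))"
    using rmod_nonneg[of "L D" y] L_pos \<delta>_pos by simp
  ultimately show "y rmod L D + \<delta> * real (card (points_below y)) \<in> {0..<\<bar>a\<bar>}"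
    using a_pos by simp
qed

lemma opened_rmod_below_hole:
  assumes "y rmod L D < l d1"
  shows "opened y rmod a < c0 - \<delta>"
proof -
  have "card (points_below y) \<le> card {n \<in> {1..D}. (real n * \<theta> k) rmod L D < l d1}"
    unfolding points_below_def by (rule card_mono) (use assms in auto)
  then have "\<delta> * real (card (points_below y)) \<le> \<delta> * real d1"
    using \<delta>_pos unfolding card_rotation by simp
  then show ?thesis
    using assms by (simp add: opened_rmod l_def algebra_simps)
qed

lemma opened_rmod_above_hole:
  assumes "l d1 \<le> y rmod L D"
  shows "c0 \<le> opened y rmod a"
proof -
  have "card (insert D {n \<in> {1..D}. (real n * \<theta> k) rmod L D < l d1}) \<le> card (points_below y)"
    unfolding points_below_def by (rule card_mono) (use assms rotation_D_rmod in auto)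
  moreover have "D \<notin> {n \<in> {1..D}. (real n * \<theta> k) rmod L D < l d1}"
    using rotation_D_rmod by simp
  ultimately have "Suc d1 \<le> card (points_below y)"
    using card_rotation by (simp del: atLeastAtMost_iff mem_Collect_eq)
  then have "\<delta> * real (Suc d1) \<le> \<delta> * real (card (points_below y))"
    using \<delta>_pos by simp
  then show ?thesis
    using assms by (simp add: opened_rmod l_def algebra_simps)
qed

definition tile :: "int \<Rightarrow> real" where
  "tile i = b * of_int ((N - k) * i + count (of_int i * \<theta> k))"

lemma tile_eq_opened:
  "tile i = opened (of_int i * \<theta> k) + a * of_int ((N - k - p) * i + count (of_int i * \<theta> k))"
  by (simp add: tile_def opened_def \<theta>_def c1_eq \<delta>_def algebra_simps)

lemma tile_successor: "tile i rmod a \<notin> hole \<and> tile (i + 1) = successor (tile i)"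
proof -
  define y where "y = of_int i * \<theta> k"
  have rmod: "tile i rmod a = opened y rmod a"
    unfolding tile_eq_opened y_def by (rule rmod_add_multiple)
  have lower: "opened y rmod a < c0 \<longleftrightarrow> y rmod L D < l d1"
    using opened_rmod_below_hole[of y] opened_rmod_above_hole[of y] \<delta>_pos by linarith
  have "tile (i + 1) = tile i + b * of_int (N + of_bool (y rmod L D < l d1))"
    using count_add_\<theta>[of y] by (simp add: tile_def y_def algebra_simps)
  then have "tile (i + 1) = successor (tile i)"
    by (simp only: successor_def rmod lower)
  moreover have "tile i rmod a \<notin> hole"
    using opened_rmod_below_hole[of y] opened_rmod_above_hole[of y] by (force simp: rmod)
  ultimately show ?thesis
    by simp
qed

lemma window_tiling_tile: "window_tiling a b c (range tile)"
proof (rule window_tiling_range[OF a_pos a_less_c])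
  fix i j
  show "tile j - tile i \<in> lattice b"
    unfolding lattice_def tile_def right_diff_distrib[symmetric] of_int_diff[symmetric] by blast
  have "tile (i + 1) = tile i + b * of_int (N + of_bool (tile i rmod a < c0))"
    using tile_successor[of i] by (simp add: successor_def)
  then show "\<lfloor>(tile (i + 1) - c) / a\<rfloor> = \<lfloor>tile i / a\<rfloor>"
    using tile_successor[of i] next_window_iff_successor by metis
qed

end

section \<open>The criterion\<close>

lemma card_plus_lattice_multiples:
  assumes "0 < L" "l \<le> L"
  shows "card {n :: int. 1 \<le> n \<and> n \<le> int D \<and> of_int n * \<theta> \<in> plus_lattice {0..<l} L}
    = card {n \<in> {1..D}. (real n * \<theta>) rmod L < l}"
proof -
  have "{n :: int. 1 \<le> n \<and> n \<le> int D \<and> of_int n * \<theta> \<in> plus_lattice {0..<l} L}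
      = int ` {n \<in> {1..D}. (real n * \<theta>) rmod L < l}" (is "?A = ?B")
  proof (intro equalityI subsetI)
    fix n assume "n \<in> ?A"
    then show "n \<in> ?B"
      by (intro image_eqI[of _ _ "nat n"]) (auto simp: mem_plus_lattice_iff[OF assms])
  next
    fix n assume "n \<in> ?B"
    then show "n \<in> ?A"
      by (auto simp: mem_plus_lattice_iff[OF assms])
  qed
  then show ?thesis
    by (simp add: card_image)
qed

context abc_parameters begin

lemma ex_window_tiling_iff_admissible:
  "(\<exists>T. window_tiling a b c T) \<longleftrightarrow> (\<exists>d1 d2 k. admissible d1 d2 k)"
proof
  assume "\<exists>T. window_tiling a b c T"
  then obtain P where "F_invariant a b c P"
    using F_invariant_of_window_tiling by blast
  then obtain D k where "gap_cycle a b c D k"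
    using F_invariant.ex_gap_cycle by blast
  then show "\<exists>d1 d2 k. admissible d1 d2 k"
    using gap_cycle.admissible by blast
next
  assume "\<exists>d1 d2 k. admissible d1 d2 k"
  then obtain d1 d2 k where "admissible_rotation a b c d1 d2 k"
    using abc_parameters_axioms
    by (auto simp: admissible_rotation_def admissible_rotation_axioms_def)
  then show "\<exists>T. window_tiling a b c T"
    using admissible_rotation.window_tiling_tile by blast
qed

definition rotation_lift :: "nat \<Rightarrow> nat \<Rightarrow> real" where
  "rotation_lift d1 d2 = ((real d1 + real d2 + 1) * c1 - c0 + (real d1 + 1) * (b - a)) / a"

lemma rotation_lift_eq_iff:
  assumes "D = d1 + d2 + 1"
  shows "rotation_lift d1 d2 = of_int k \<longleftrightarrow> real D * \<theta> k = l d1 + L D * of_int k"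
proof -
  have "rotation_lift d1 d2 = of_int k \<longleftrightarrow> real D * c1 - c0 + (real d1 + 1) * \<delta> = a * of_int k"
    using a_pos by (simp add: rotation_lift_def assms \<delta>_def divide_eq_eq algebra_simps)
  also have "\<dots> \<longleftrightarrow> real D * \<theta> k = l d1 + L D * of_int k"
    by (auto simp: \<theta>_def l_def L_def algebra_simps)
  finally show ?thesis .
qed

lemma lattice_condition_iff:
  "c - (real d1 + 1) * (of_int N + 1) * (b - a) - (real d2 + 1) * of_int N * (b - a) \<in> lattice a
    \<longleftrightarrow> (\<exists>k. rotation_lift d1 d2 = of_int k)" (is "?v \<in> _ \<longleftrightarrow> _")
proof -
  define M where "M = N + int (d1 + d2 + 1) * p"
  have "a * rotation_lift d1 d2 = (real d1 + real d2 + 1) * c1 - c0 + (real d1 + 1) * \<delta>"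
    using a_pos by (simp add: rotation_lift_def \<delta>_def)
  then have v: "?v = a * (of_int M - rotation_lift d1 d2)"
    unfolding right_diff_distrib by (simp add: M_def c0_def c1_eq \<delta>_def algebra_simps)
  have eq: "?v = a * of_int (M - k) \<longleftrightarrow> rotation_lift d1 d2 = of_int k" for k
    unfolding v using a_pos by auto
  show ?thesis
  proof
    assume "?v \<in> lattice a"
    then obtain j where "?v = a * of_int (M - (M - j))"
      unfolding lattice_def by auto
    then show "\<exists>k. rotation_lift d1 d2 = of_int k"
      unfolding eq by blast
  next
    assume "\<exists>k. rotation_lift d1 d2 = of_int k"
    then show "?v \<in> lattice a"
      unfolding eq[symmetric] lattice_def by blast
  qed
qed

lemma card_condition_iff:
  assumes "D = d1 + d2 + 1" "l d1 < L D" "0 < l d1"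
  shows "card {n::int. 1 \<le> n \<and> n \<le> int d1 + int d2 + 1 \<and> of_int n * (c1 - of_int k * (b - a))
      \<in> plus_lattice {0..<c0 - (real d1 + 1) * (b - a)} (a - (real d1 + real d2 + 1) * (b - a))}
    = card {n \<in> {1..D}. (real n * \<theta> k) rmod L D < l d1}"
proof -
  have D: "int d1 + int d2 + 1 = int D" "real d1 + real d2 + 1 = real D"
    by (simp_all add: assms(1))
  show ?thesis
    using card_plus_lattice_multiples[of "L D" "l d1" D "\<theta> k"] assms(2,3)
    unfolding D \<theta>_def l_def L_def \<delta>_def by simp
qed

lemma ex_admissible_iff:
  "(\<exists>k. admissible d1 d2 k) \<longleftrightarrow>
     c - (real d1 + 1) * (of_int N + 1) * (b - a) - (real d2 + 1) * of_int N * (b - a) \<in> lattice a \<and>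
     of_int N * b + (real d1 + 1) * (b - a) < c \<and>
     c < of_int N * b + b - (real d2 + 1) * (b - a) \<and>
     (let m = ((real d1 + real d2 + 1) * c1 - c0 + (real d1 + 1) * (b - a)) / a;
          E = {n::int. 1 \<le> n \<and> n \<le> int d1 + int d2 + 1 \<and>
                 of_int n * (c1 - m * (b - a))
                   \<in> plus_lattice {0..<c0 - (real d1 + 1) * (b - a)}
                                  (a - (real d1 + real d2 + 1) * (b - a))}
      in card E = d1)"
proof -
  define D where "D = d1 + d2 + 1"
  have lower: "of_int N * b + (real d1 + 1) * (b - a) < c \<longleftrightarrow> 0 < l d1"
    by (auto simp: l_def c0_def \<delta>_def)
  have upper: "c < of_int N * b + b - (real d2 + 1) * (b - a) \<longleftrightarrow> l d1 < L D"
    by (auto simp: l_def L_def c0_def \<delta>_def D_def algebra_simps)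
  show ?thesis
    unfolding admissible_def Let_def D_def[symmetric] rotation_lift_eq_iff[OF D_def, symmetric]
      rotation_lift_def[symmetric] lattice_condition_iff lower upper
    using card_condition_iff[OF D_def] by auto
qed

end

theorem theorem6p1:
  fixes a b c :: real
  defines "N \<equiv> \<lfloor>c / b\<rfloor>"
  defines "c0 \<equiv> c - of_int \<lfloor>c / b\<rfloor> * b"
  defines "c1 \<equiv> c - (c - of_int \<lfloor>c / b\<rfloor> * b)
                 - of_int \<lfloor>(c - (c - of_int \<lfloor>c / b\<rfloor> * b)) / a\<rfloor> * a"
  assumes "0 < a" "a < b" "b < c"
    and "N \<ge> 2"
    and "b - a < c0" "c0 < a"
    and "0 < c1" "c1 < 2 * a - b"
    and "a / b \<notin> \<rat>"
  shows "S_set a b c \<noteq> {} \<longleftrightarrow>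
    (\<exists>d1 d2 :: nat.
       c - (real d1 + 1) * (of_int N + 1) * (b - a) - (real d2 + 1) * of_int N * (b - a)
         \<in> lattice a
     \<and> of_int N * b + (real d1 + 1) * (b - a) < c
     \<and> c < of_int N * b + b - (real d2 + 1) * (b - a)
     \<and> (let m = ((real d1 + real d2 + 1) * c1 - c0 + (real d1 + 1) * (b - a)) / a;
            E = {n::int. 1 \<le> n \<and> n \<le> int d1 + int d2 + 1 \<and>
                   of_int n * (c1 - m * (b - a))
                     \<in> plus_lattice {0..<c0 - (real d1 + 1) * (b - a)}
                                    (a - (real d1 + real d2 + 1) * (b - a))}
        in card E = d1))"
proof -
  interpret abc: abc_parameters a b c
    using assms by unfold_locales simp_all
  have N: "N = abc.N" and c0: "c0 = abc.c0" and c1: "c1 = abc.c1"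
    unfolding N_def c0_def c1_def abc.N_def abc.c0_def abc.c1_def by (rule refl)+
  have "S_set a b c \<noteq> {} \<longleftrightarrow> (\<exists>T. window_tiling a b c T)"
    using \<open>0 < a\<close> \<open>a < b\<close> by (intro S_set_nonempty_iff_window_tiling) simp
  also have "\<dots> \<longleftrightarrow> (\<exists>d1 d2 k. abc.admissible d1 d2 k)"
    by (rule abc.ex_window_tiling_iff_admissible)
  finally show ?thesis
    unfolding abc.ex_admissible_iff N c0 c1 .
qed

end
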